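(* Let $U\subset\mathbb{R}^V$ be a graph shift-invariant space. Then the following statements are equivalent: (i) $\mathbf{S}_1U=\cdots=\mathbf{S}_dU=U$. (ii) $\mathbf{S}_1\cdots\mathbf{S}_dU=U$. (iii) $\dim_U(\boldsymbol{\gamma}(m))=0$ for every $1\le m\le M$ with $\gamma_1(m)\cdots\gamma_d(m)=0$.
   Context: Let $\mathcal{G}=(V,E,\mathbf{W})$ be a finite, simple, undirected graph with $N\ge 2$ vertices. A graph signal is a vector in $\mathbb{R}^V$. A graph shift is a matrix $\mathbf{S}=[s(i,j)]_{i,j\in V}$ with $s(i,j)=0$ unless $i=j$ or $(i,j)\in E$. Standing assumption: $\mathbf{S}_1,\ldots,\mathbf{S}_d$ are graph shifts that are real-valued, symmetric and pairwise commuting. Choose an orthogonal matrix $\mathbf{U}=[\mathbf{u}_1,\ldots,\mathbf{u}_N]$ with $\mathbf{S}_l=\sum_{n=1}^N\lambda_l(n)\mathbf{u}_n\mathbf{u}_n^T$ for $1\le l\le d$, and set $\boldsymbol{\lambda}(n)=[\lambda_1(n),\ldots,\lambda_d(n)]^T\in\mathbb{R}^d$. Let $\boldsymbol{\gamma}(m)=[\gamma_1(m),\ldots,\gamma_d(m)]^T$, $1\le m\le M$, be the distinct elements of $\{\boldsymbol{\lambda}(n): 1\le n\le N\}$, and let $W_m=\bigcap_{l=1}^d\ker(\mathbf{S}_l-\gamma_l(m)\mathbf{I})$. A graph shift-invariant space is a linear space $U$ of graph signals such that $\mathbf{S}_l\mathbf{x}\in U$ for all $1\le l\le d$ and $\mathbf{x}\in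 U$. Its dimension function is $\dim_U(\boldsymbol{\gamma}(m))=\dim(U\cap W_m)$, $1\le m\le M$. For a matrix $\mathbf{A}$, $\mathbf{A}U=\{\mathbf{A}\mathbf{x}:\mathbf{x}\in U\}$. *)

theory Defs
  imports "HOL-Analysis.Analysis"
begin

text \<open>
  The vertex set is the finite type \<open>'v\<close> and a graph signal is a vector of type \<open>real ^ 'v\<close>.
  The shifts \<open>S l\<close> are indexed by a nonempty finite linearly ordered type \<open>'d\<close>, standing for
  \<open>{1,...,d}\<close>; the order matters only for writing the product of all shifts.
\<close>

definition simple_graph :: "'v rel \<Rightarrow> bool" where
  "simple_graph E \<longleftrightarrow> sym E \<and> irrefl E"

definition graph_shift :: "'v rel \<Rightarrow> real ^ 'v ^ 'v \<Rightarrow> bool" where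
  "graph_shift E A \<longleftrightarrow> (\<forall>i j. i \<noteq> j \<and> (i, j) \<notin> E \<longrightarrow> A $ i $ j = 0)"

definition rank_one :: "real ^ 'v \<Rightarrow> real ^ 'v ^ 'v" where
  \<comment> \<open>the matrix \<open>u u\<^sup>T\<close>\<close>
  "rank_one u = (\<chi> i j. u $ i * u $ j)"

text \<open>
  The columns of \<open>Q\<close> are the joint eigenvectors and \<open>lam n\<close> is the vector of eigenvalues belonging
  to column \<open>n\<close>. As \<open>Q\<close> is square, its columns are indexed by \<open>'v\<close> instead of \<open>{1,...,N}\<close>.
\<close>

definition joint_diagonalization ::
    "('d \<Rightarrow> real ^ 'v ^ 'v) \<Rightarrow> real ^ 'v ^ 'v \<Rightarrow> ('v \<Rightarrow> real ^ 'd) \<Rightarrow> bool" where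
  "joint_diagonalization S Q lam \<longleftrightarrow>
     orthogonal_matrix Q \<and>
     (\<forall>l. S l = (\<Sum>n\<in>UNIV. (lam n $ l) *\<^sub>R rank_one (column n Q)))"

definition joint_eigenspace :: "('d \<Rightarrow> real ^ 'v ^ 'v) \<Rightarrow> real ^ 'd \<Rightarrow> (real ^ 'v) set" where
  "joint_eigenspace S g = (\<Inter>l. {x. (S l - (g $ l) *\<^sub>R mat 1) *v x = 0})"

definition graph_shift_invariant_space ::
    "('d \<Rightarrow> real ^ 'v ^ 'v) \<Rightarrow> (real ^ 'v) set \<Rightarrow> bool" where
  "graph_shift_invariant_space S U \<longleftrightarrow> subspace U \<and> (\<forall>l. \<forall>x\<in>U. S l *v x \<in> U)"

definition dimension_function ::
    "('d \<Rightarrow> real ^ 'v ^ 'v) \<Rightarrow> (real ^ 'v) set \<Rightarrow> real ^ 'd \<Rightarrow> nat" where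
  "dimension_function S U g = dim (U \<inter> joint_eigenspace S g)"

definition matrix_image :: "real ^ 'v ^ 'v \<Rightarrow> (real ^ 'v) set \<Rightarrow> (real ^ 'v) set" where
  "matrix_image A U = (\<lambda>x. A *v x) ` U"

definition shift_product :: "('d :: {finite, linorder} \<Rightarrow> real ^ 'v ^ 'v) \<Rightarrow> real ^ 'v ^ 'v" where
  \<comment> \<open>\<open>S\<^sub>1 ** \<dots> ** S\<^sub>d\<close>; the operation \<open>*\<close> on this type, hence \<open>prod\<close>, is componentwise\<close>
  "shift_product S = foldr (\<lambda>l A. S l ** A) (sorted_list_of_set UNIV) (mat 1)"

end

theory Submission
  imports Defs
begin

text \<open>
  The key point is that every nonzero graph shift-invariant space \<open>V\<close> contains a joint eigenvector:
  a nonzero \<open>x \<in> V\<close> with as few nonzero coefficients \<open>x \<bullet> u\<^sub>n\<close> as possible is annihilated by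
  \<open>S\<^sub>l - \<lambda>\<^sub>l(n) I\<close> for every \<open>n\<close> in its support, because the image lies in \<open>V\<close> and has smaller
  support. Applied to \<open>V = U \<inter> ker S\<^sub>l\<close>, this shows that (iii) makes \<open>S\<^sub>l\<close> injective on \<open>U\<close>, which
  gives (i). Conversely, a joint eigenvector \<open>x \<in> U\<close> with vanishing eigenvalue product is orthogonal
  to \<open>S\<^sub>1 \<dots> S\<^sub>d U\<close> by symmetry, so \<open>S\<^sub>1 \<dots> S\<^sub>d U = U\<close> forces \<open>x = 0\<close>.
\<close>

lemma rank_one_mult_vec: "rank_one u *v x = (u \<bullet> x) *\<^sub>R (u :: real ^ 'v::finite)"
  unfolding rank_one_def matrix_vector_mult_def inner_vec_def vec_eq_iff
  by (auto simp: sum_distrib_right intro!: sum.cong)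

lemma sum_matrix_vec_mult:
  fixes A :: "'i \<Rightarrow> real ^ 'n::finite ^ 'm"
  shows "(\<Sum>i\<in>I. A i) *v x = (\<Sum>i\<in>I. A i *v x)"
  by (induction I rule: infinite_finite_induct) (simp_all add: matrix_vector_mult_add_rdistrib)

lemma column_inner_column:
  fixes Q :: "real ^ 'v::finite ^ 'v"
  assumes "orthogonal_matrix Q"
  shows "column i Q \<bullet> column j Q = (if i = j then 1 else 0)"
proof -
  have "transpose Q ** Q = mat 1"
    using assms by (simp add: orthogonal_matrix)
  then have "(transpose Q ** Q) $ i $ j = (mat 1 :: real ^ 'v ^ 'v) $ i $ j"
    by simp
  then show ?thesis
    by (simp add: matrix_matrix_mult_def transpose_def column_def inner_vec_def mat_def)
qed

text \<open>The inner products are the entries of \<open>transpose Q *v x\<close>, and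
  \<open>Q\<close> inverts \<open>transpose Q\<close>.\<close>

lemma orthogonal_matrix_inner_columns_eq_0:
  fixes Q :: "real ^ 'v::finite ^ 'v"
  assumes "orthogonal_matrix Q" and "\<And>n. x \<bullet> column n Q = 0"
  shows "x = 0"
proof -
  have "transpose Q *v x = 0"
    using assms(2) by (simp add: vec_eq_iff matrix_vector_mult_def transpose_def column_def
        inner_vec_def mult.commute)
  then have "(Q ** transpose Q) *v x = 0"
    by (simp flip: matrix_vector_mul_assoc)
  then show ?thesis
    using assms(1) by (simp add: orthogonal_matrix_def)
qed

text \<open>Orthonormality of the columns kills every rank-one term except the one with
  \<open>k = n\<close>.\<close>

lemma joint_diagonalization_column:
  fixes S :: "'d::finite \<Rightarrow> real ^ 'v::finite ^ 'v"
  assumes "joint_diagonalization S Q lam"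
  shows "S l *v column n Q = (lam n $ l) *\<^sub>R column n Q"
proof -
  have "orthogonal_matrix Q" and S: "S l = (\<Sum>k\<in>UNIV. (lam k $ l) *\<^sub>R rank_one (column k Q))"
    using assms by (auto simp: joint_diagonalization_def)
  then show ?thesis
    by (simp add: sum_matrix_vec_mult scaleR_matrix_vector_assoc[symmetric] rank_one_mult_vec
        column_inner_column if_distrib if_distribR sum.delta cong: if_cong)
qed

lemma mem_joint_eigenspace: "x \<in> joint_eigenspace S g \<longleftrightarrow> (\<forall>l. S l *v x = (g $ l) *\<^sub>R x)"
  by (auto simp: joint_eigenspace_def matrix_vector_mult_diff_rdistrib
      scaleR_matrix_vector_assoc[symmetric])

lemma symmetric_matrix_inner:
  fixes A :: "real ^ 'v::finite ^ 'v"
  assumes "transpose A = A"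
  shows "(A *v x) \<bullet> y = x \<bullet> (A *v y)"
  using assms by (metis dot_lmul_matrix transpose_matrix_vector)

lemma invariant_space_joint_eigenvector:
  fixes S :: "'d::finite \<Rightarrow> real ^ 'v::finite ^ 'v"
  assumes sym: "\<And>l. transpose (S l) = S l"
    and diag: "joint_diagonalization S Q lam"
    and inv: "graph_shift_invariant_space S V"
    and y: "y \<in> V" "y \<noteq> 0"
  obtains x n where "x \<in> V" "x \<noteq> 0" "x \<in> joint_eigenspace S (lam n)"
proof -
  define supp where "supp = (\<lambda>x. {n. x \<bullet> column n Q \<noteq> 0})"
  have Q: "orthogonal_matrix Q"
    using diag by (simp add: joint_diagonalization_def)
  obtain x where x: "x \<in> V" "x \<noteq> 0"
    and least: "\<And>z. z \<in> V \<Longrightarrow> z \<noteq> 0 \<Longrightarrow> card (supp x) \<le> card (supp z)"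
    using ex_has_least_nat[of "\<lambda>x. x \<in> V \<and> x \<noteq> 0" y "\<lambda>x. card (supp x)"] y by auto
  \<comment> \<open>Any index in the support of \<open>x\<close> will do; there is one because the
    columns of \<open>Q\<close> span the whole space.\<close>
  obtain n where n: "x \<bullet> column n Q \<noteq> 0"
    using orthogonal_matrix_inner_columns_eq_0[OF Q] x(2) by blast
  have "S l *v x = (lam n $ l) *\<^sub>R x" for l
  proof (rule ccontr)
    define z where "z = S l *v x - (lam n $ l) *\<^sub>R x"
    assume "S l *v x \<noteq> (lam n $ l) *\<^sub>R x"
    then have "z \<noteq> 0"
      by (simp add: z_def)
    moreover have "z \<in> V"
      using inv x(1) by (simp add: z_def graph_shift_invariant_space_def subspace_diff subspace_mul)
    ultimately have le: "card (supp x) \<le> card (supp z)"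
      by (rule least[rotated])
    \<comment> \<open>Symmetry moves \<open>S l\<close> onto the eigenvector
      \<open>column k Q\<close>. The resulting factor vanishes at \<open>k = n\<close>, so passing
      from \<open>x\<close> to \<open>z\<close> creates no new support and removes
      \<open>n\<close>.\<close>
    have "z \<bullet> column k Q = (lam k $ l - lam n $ l) * (x \<bullet> column k Q)" for k
      by (simp add: z_def inner_diff_left symmetric_matrix_inner[OF sym]
          joint_diagonalization_column[OF diag] algebra_simps)
    then have "supp z \<subset> supp x"
      using n by (auto simp: supp_def)
    then show False
      using le psubset_card_mono[of "supp x" "supp z"] by simp
  qed
  then show thesis
    using that[of x n] x by (simp add: mem_joint_eigenspace)
qed

lemma matrix_image_mult: "matrix_image (A ** B) U = matrix_image A (matrix_image B U)"
  by (simp add: matrix_image_def image_image matrix_vector_mul_assoc)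

lemma matrix_image_shift_product:
  assumes "\<And>l. matrix_image (S l) U = U"
  shows "matrix_image (shift_product S) U = U"
proof -
  have "matrix_image (foldr (\<lambda>l A. S l ** A) ls (mat 1)) U = U" for ls
    by (induction ls) (simp_all add: matrix_image_mult assms, simp add: matrix_image_def)
  then show ?thesis
    by (simp add: shift_product_def)
qed

text \<open>By symmetry each factor, outermost first, can be moved onto \<open>x\<close>, where it
  acts as the scalar \<open>g $ l\<close>. If these scalars have product zero, \<open>x\<close> is
  orthogonal to the range of the shift product.\<close>

lemma joint_eigenspace_inner_shift_product:
  fixes S :: "'d::{finite, linorder} \<Rightarrow> real ^ 'v::finite ^ 'v"
  assumes sym: "\<And>l. transpose (S l) = S l" and x: "x \<in> joint_eigenspace S g"
  shows "x \<bullet> (shift_product S *v y) = (\<Prod>l\<in>UNIV. g $ l) * (x \<bullet> y)"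
proof -
  have "x \<bullet> (foldr (\<lambda>l A. S l ** A) ls (mat 1) *v y) = prod_list (map (($) g) ls) * (x \<bullet> y)" for ls
  proof (induction ls)
    case (Cons l ls)
    let ?z = "foldr (\<lambda>l A. S l ** A) ls (mat 1) *v y"
    have "x \<bullet> (S l *v ?z) = g $ l * (x \<bullet> ?z)"
      using x by (simp add: symmetric_matrix_inner[OF sym, symmetric] mem_joint_eigenspace)
    with Cons show ?case
      by (simp flip: matrix_vector_mul_assoc)
  qed simp
  then show ?thesis
    using prod.distinct_set_conv_list[of "sorted_list_of_set UNIV" "($) g"]
    by (simp add: shift_product_def)
qed

text \<open>Injectivity on \<open>U\<close> preserves dimension, so the image is a subspace of
  \<open>U\<close> of full dimension.\<close>

lemma matrix_image_eq_if_trivial_kernel: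
  fixes A :: "real ^ 'v::finite ^ 'v"
  assumes U: "subspace U" and "\<And>x. x \<in> U \<Longrightarrow> A *v x \<in> U"
    and ker: "\<And>x. x \<in> U \<Longrightarrow> A *v x = 0 \<Longrightarrow> x = 0"
  shows "matrix_image A U = U"
proof -
  have "inj_on ((*v) A) U"
  proof (rule inj_onI)
    fix x y assume "x \<in> U" "y \<in> U" "A *v x = A *v y"
    then show "x = y"
      using ker[of "x - y"] subspace_diff[OF U, of x y]
      by (simp add: matrix_vector_mult_diff_distrib)
  qed
  then have "dim ((*v) A ` U) = dim U"
    using U by (metis dim_image_eq matrix_vector_mul_linear span_eq_iff)
  then show ?thesis
    unfolding matrix_image_def
    using U assms(2) by (intro subspace_dim_equal linear_subspace_image) (simp_all add: image_subset_iff)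
qed

theorem theorem3p14:
  fixes E :: "'v::finite rel"
    and S :: "'d::{finite, linorder} \<Rightarrow> real ^ 'v ^ 'v"
    and Q :: "real ^ 'v ^ 'v"
    and lam :: "'v \<Rightarrow> real ^ 'd::{finite, linorder}"
    and gam :: "nat \<Rightarrow> real ^ 'd::{finite, linorder}"
    and M :: nat
    and U :: "(real ^ 'v) set"
  assumes "CARD('v) \<ge> 2"
    and "simple_graph E"
    and "\<And>l. graph_shift E (S l)"
    and "\<And>l. transpose (S l) = S l"
    and "\<And>k l. S k ** S l = S l ** S k"
    and "joint_diagonalization S Q lam"
    and "bij_betw gam {1..M} (range lam)"
    and "graph_shift_invariant_space S U"
  shows "((\<forall>l. matrix_image (S l) U = U) \<longleftrightarrow> matrix_image (shift_product S) U = U) \<and>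
         (matrix_image (shift_product S) U = U \<longleftrightarrow>
           (\<forall>m\<in>{1..M}. (\<Prod>l\<in>UNIV. gam m $ l) = 0 \<longrightarrow> dimension_function S U (gam m) = 0))"
proof -
  have U: "subspace U" and inv: "\<And>l x. x \<in> U \<Longrightarrow> S l *v x \<in> U"
    using assms(8) by (auto simp: graph_shift_invariant_space_def)
  have dim_0: "dimension_function S U g = 0 \<longleftrightarrow> (\<forall>x\<in>U. x \<in> joint_eigenspace S g \<longrightarrow> x = 0)" for g
    by (auto simp: dimension_function_def)
  have ii_iii: "dimension_function S U g = 0"
    if P: "matrix_image (shift_product S) U = U" and g: "(\<Prod>l\<in>UNIV. g $ l) = 0" for g
    unfolding dim_0
  proof (intro ballI impI)
    fix x assume "x \<in> U" and x: "x \<in> joint_eigenspace S g"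
    \<comment> \<open>By (ii), \<open>x\<close> itself lies in the image to which it is
      orthogonal.\<close>
    then obtain y where "x = shift_product S *v y"
      using P by (auto simp: matrix_image_def)
    then have "x \<bullet> x = 0"
      using joint_eigenspace_inner_shift_product[OF assms(4) x, of y] g by simp
    then show "x = 0"
      by simp
  qed
  have iii_i: "matrix_image (S l) U = U"
    if iii: "\<forall>m\<in>{1..M}. (\<Prod>l\<in>UNIV. gam m $ l) = 0 \<longrightarrow> dimension_function S U (gam m) = 0" for l
  proof (rule matrix_image_eq_if_trivial_kernel[OF U inv])
    fix y assume y: "y \<in> U" "S l *v y = 0"
    define V where "V = {x \<in> U. S l *v x = 0}"
    \<comment> \<open>Commutation is what makes the kernel of \<open>S l\<close> within
      \<open>U\<close> invariant under all the other shifts.\<close>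
    have "S l *v (S k *v x) = S k *v (S l *v x)" for k x
      by (simp add: matrix_vector_mul_assoc assms(5)[of l k])
    then have "graph_shift_invariant_space S V"
      using U inv by (auto simp: V_def graph_shift_invariant_space_def subspace_def
          matrix_vector_right_distrib matrix_vector_mult_scaleR)
    note joint_eigenvector = invariant_space_joint_eigenvector[OF assms(4,6) this]
    show "y = 0"
    proof (rule ccontr)
      assume "y \<noteq> 0"
      then obtain x n where x: "x \<in> V" "x \<noteq> 0" "x \<in> joint_eigenspace S (lam n)"
        using joint_eigenvector[of y] y by (auto simp: V_def)
      \<comment> \<open>The nonzero vector \<open>x\<close> is killed by \<open>S l\<close> and also
        scaled by \<open>lam n $ l\<close>.\<close>
      then have "lam n $ l = 0"
        by (auto simp: V_def mem_joint_eigenspace dest!: spec[of _ l])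
      then have "(\<Prod>l\<in>UNIV. lam n $ l) = 0"
        by auto
      \<comment> \<open>Since \<open>gam\<close> enumerates all joint eigenvalues, (iii) applies to
        \<open>lam n\<close>.\<close>
      moreover obtain m where "m \<in> {1..M}" "lam n = gam m"
        using assms(7) by (metis bij_betw_imp_surj_on imageE rangeI)
      ultimately have "dimension_function S U (lam n) = 0"
        using iii by simp
      then show False
        using x by (auto simp: dim_0 V_def)
    qed
  qed
  show ?thesis
  proof (intro conjI iffI ballI impI)
    assume "\<forall>l. matrix_image (S l) U = U"
    then show "matrix_image (shift_product S) U = U"
      by (simp add: matrix_image_shift_product)
  next
    assume "matrix_image (shift_product S) U = U"
    \<comment> \<open>The passage from (ii) to (i) goes through (iii).\<close>
    then show "\<forall>l. matrix_image (S l) U = U"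
      using ii_iii iii_i by simp
  next
    fix m assume "matrix_image (shift_product S) U = U" "(\<Prod>l\<in>UNIV. gam m $ l) = 0"
    then show "dimension_function S U (gam m) = 0"
      by (rule ii_iii)
  next
    assume "\<forall>m\<in>{1..M}. (\<Prod>l\<in>UNIV. gam m $ l) = 0 \<longrightarrow> dimension_function S U (gam m) = 0"
    then show "matrix_image (shift_product S) U = U"
      by (intro matrix_image_shift_product iii_i)
  qed
qed

end
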